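(* Let $\Omega$ be a set, let $\mathcal{C}$ be a collection of subsets of $\Omega$, and let $\mathcal{F}=\sigma(\mathcal{C})$. If $\kappa(\mathcal{C})=\sigma(\mathcal{C})$, then for every $\omega\in\Omega$, $A_{\mathcal{C}}(\omega)=A_{\mathcal{F}}(\omega)$.
   Context: For a collection $\mathcal{C}$ of subsets of $\Omega$: $\sigma(\mathcal{C})$ is the smallest $\sigma$-algebra on $\Omega$ containing $\mathcal{C}$. A collection of subsets of $\Omega$ is called a $\kappa$ class if it is closed under countable intersection and countable union (i.e. whenever $A_n$, $n\ge 1$, belong to it, so do $\bigcup_{n\ge1}A_n$ and $\bigcap_{n\ge 1}A_n$); $\kappa(\mathcal{C})$ is the smallest $\kappa$ class containing $\mathcal{C}$. For $\omega\in\Omega$, $\mathcal{C}_{\omega}=\{B\in\mathcal{C}: \omega\in B\}$ and $A_{\mathcal{C}}(\omega)=\bigcap_{B\in\mathcal{C}_{\omega}}B$, with the convention $A_{\mathcal{C}}(\omega)=\emptyset$ if $\mathcal{C}_\omega$ is empty. The atom of the $\sigma$-algebra $\mathcal{F}$ containing $\omega$ is $A_{\mathcal{F}}(\omega)=\bigcap_{B\in\mathcal{F},\,\omega\in B}B$. *)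

theory Defs
  imports "HOL-Analysis.Sigma_Algebra"
begin

(* Only nonempty countable families are considered, so a kappa class
   need not contain the empty set or \<Omega>. *)
definition kappa_class :: "'a set \<Rightarrow> 'a set set \<Rightarrow> bool" where
  "kappa_class \<Omega> K \<longleftrightarrow> K \<subseteq> Pow \<Omega> \<and>
     (\<forall>A :: nat \<Rightarrow> 'a set. range A \<subseteq> K \<longrightarrow> (\<Union>n. A n) \<in> K \<and> (\<Inter>n. A n) \<in> K)"

definition kappa_sets :: "'a set \<Rightarrow> 'a set set \<Rightarrow> 'a set set" where
  "kappa_sets \<Omega> C = kappa_class \<Omega> hull C"

lemma kappa_class_Pow: "kappa_class \<Omega> (Pow \<Omega>)"
  unfolding kappa_class_def by blast

lemma kappa_class_kappa_sets:
  assumes "C \<subseteq> Pow \<Omega>"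
  shows "kappa_class \<Omega> (kappa_sets \<Omega> C)"
proof -
  have "kappa_sets \<Omega> C \<subseteq> Pow \<Omega>"
    unfolding kappa_sets_def by (rule hull_minimal[of C "Pow \<Omega>" "kappa_class \<Omega>", OF assms kappa_class_Pow])
  moreover have "(\<Union>n. A n) \<in> kappa_sets \<Omega> C \<and> (\<Inter>n. A n) \<in> kappa_sets \<Omega> C"
    if A: "range A \<subseteq> kappa_sets \<Omega> C" for A :: "nat \<Rightarrow> 'a set"
  proof -
    have "(\<Union>n. A n) \<in> K \<and> (\<Inter>n. A n) \<in> K" if K: "kappa_class \<Omega> K" "C \<subseteq> K" for K
    proof -
      have "range A \<subseteq> K"
        using A hull_minimal[of C K "kappa_class \<Omega>"] K unfolding kappa_sets_def by blast
      then show ?thesis using K(1) unfolding kappa_class_def by blast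
    qed
    then show ?thesis unfolding kappa_sets_def hull_def by blast
  qed
  ultimately show ?thesis unfolding kappa_class_def by blast
qed

lemma subset_kappa_sets: "C \<subseteq> kappa_sets \<Omega> C"
  unfolding kappa_sets_def by (rule hull_subset)

lemma kappa_sets_minimal: "C \<subseteq> K \<Longrightarrow> kappa_class \<Omega> K \<Longrightarrow> kappa_sets \<Omega> C \<subseteq> K"
  unfolding kappa_sets_def by (rule hull_minimal)

definition members_at :: "'a set set \<Rightarrow> 'a \<Rightarrow> 'a set set" where
  "members_at C \<omega> = {B \<in> C. \<omega> \<in> B}"

(* The case distinction is needed: the library has \<Inter>{} = UNIV. *)
definition atom_at :: "'a set set \<Rightarrow> 'a \<Rightarrow> 'a set" where
  "atom_at C \<omega> = (if members_at C \<omega> = {} then {} else \<Inter>(members_at C \<omega>))"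

end

theory Submission imports Defs begin

text \<open>
  For fixed points \<open>\<omega>\<close> and \<open>x\<close>, the subsets \<open>B\<close> of \<open>\<Omega>\<close> such that \<open>\<omega> \<in> B\<close> implies \<open>x \<in> B\<close>
  form a \<open>\<kappa>\<close> class, and so do those that avoid \<open>\<omega>\<close>. If either of these classes contains \<open>C\<close>,
  then it contains \<open>\<kappa>(C)\<close>. Hence \<open>C\<close> and \<open>\<kappa>(C)\<close> have the same atoms, for every collection \<open>C\<close>
  of subsets of \<open>\<Omega>\<close>; avoidance takes care of the points covered by no member of \<open>C\<close>, whose
  atom is empty by convention. The theorem is the case \<open>\<kappa>(C) = \<sigma>(C)\<close>.
\<close>

lemma kappa_class_avoiding: "kappa_class \<Omega> {B \<in> Pow \<Omega>. \<omega> \<notin> B}"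
  unfolding kappa_class_def by blast

lemma kappa_class_not_separating: "kappa_class \<Omega> {B \<in> Pow \<Omega>. \<omega> \<in> B \<longrightarrow> x \<in> B}"
  unfolding kappa_class_def by blast

lemma members_at_kappa_sets_empty_iff:
  assumes "C \<subseteq> Pow \<Omega>"
  shows "members_at (kappa_sets \<Omega> C) \<omega> = {} \<longleftrightarrow> members_at C \<omega> = {}"
proof
  assume "members_at (kappa_sets \<Omega> C) \<omega> = {}"
  then show "members_at C \<omega> = {}"
    using subset_kappa_sets[of C \<Omega>] unfolding members_at_def by blast
next
  assume "members_at C \<omega> = {}"
  then have "C \<subseteq> {B \<in> Pow \<Omega>. \<omega> \<notin> B}"
    using assms unfolding members_at_def by blast
  then have "kappa_sets \<Omega> C \<subseteq> {B \<in> Pow \<Omega>. \<omega> \<notin> B}"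
    using kappa_class_avoiding by (rule kappa_sets_minimal)
  then show "members_at (kappa_sets \<Omega> C) \<omega> = {}"
    unfolding members_at_def by blast
qed

lemma Inter_members_at_kappa_sets:
  assumes "C \<subseteq> Pow \<Omega>"
  shows "\<Inter>(members_at (kappa_sets \<Omega> C) \<omega>) = \<Inter>(members_at C \<omega>)"
proof
  show "\<Inter>(members_at (kappa_sets \<Omega> C) \<omega>) \<subseteq> \<Inter>(members_at C \<omega>)"
    using subset_kappa_sets[of C \<Omega>] unfolding members_at_def by blast
  show "\<Inter>(members_at C \<omega>) \<subseteq> \<Inter>(members_at (kappa_sets \<Omega> C) \<omega>)"
  proof
    fix x assume "x \<in> \<Inter>(members_at C \<omega>)"
    then have "C \<subseteq> {B \<in> Pow \<Omega>. \<omega> \<in> B \<longrightarrow> x \<in> B}"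
      using assms unfolding members_at_def by blast
    then have "kappa_sets \<Omega> C \<subseteq> {B \<in> Pow \<Omega>. \<omega> \<in> B \<longrightarrow> x \<in> B}"
      using kappa_class_not_separating by (rule kappa_sets_minimal)
    then show "x \<in> \<Inter>(members_at (kappa_sets \<Omega> C) \<omega>)"
      unfolding members_at_def by blast
  qed
qed

lemma atom_at_kappa_sets:
  assumes "C \<subseteq> Pow \<Omega>"
  shows "atom_at (kappa_sets \<Omega> C) \<omega> = atom_at C \<omega>"
  unfolding atom_at_def
  by (simp add: members_at_kappa_sets_empty_iff[OF assms] Inter_members_at_kappa_sets[OF assms])

theorem corollary4p3:
  fixes \<Omega> :: "'a set" and C F :: "'a set set"
  assumes "C \<subseteq> Pow \<Omega>"
    and "F = sigma_sets \<Omega> C"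
    and "kappa_sets \<Omega> C = sigma_sets \<Omega> C"
  shows "\<forall>\<omega>\<in>\<Omega>. atom_at C \<omega> = atom_at F \<omega>"
  using atom_at_kappa_sets[OF assms(1)] assms(2,3) by simp

end
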